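(* Let $s$ be a positive integer. For all integers $n$ and $k$ with $2\le k\le n$, $$\left\{ {n \atop k} \right\}_s=\sum_{j=1}^{k-1}\frac{j^{(k-1)s}\bigl(j^{(n-k+1)s}-k^{(n-k+1)s}\bigr)}{\prod_{i=0,\, i\neq j}^{k}(j^s-i^s)},$$ and $\left\{ {n \atop 1} \right\}_s=1$ for all $n\ge 1$.
   Context: For a positive integer $s$, the Stirling numbers of the second kind with level $s$, $\left\{ {n \atop k} \right\}_s$ ($n,k\ge 0$), are defined by the recurrence $\left\{ {n \atop k} \right\}_s=\left\{ {n-1 \atop k-1} \right\}_s+k^s\left\{ {n-1 \atop k} \right\}_s$ with $\left\{ {0 \atop 0} \right\}_s=1$ and $\left\{ {n \atop 0} \right\}_s=\left\{ {0 \atop n} \right\}_s=0$ for $n\ge 1$. Equivalently, $\left\{ {n \atop k} \right\}_s$ is the number of ordered $s$-tuples $(\pi_1,\dots,\pi_s)$ of set partitions of $\{1,\dots,n\}$ into exactly $k$ nonempty blocks such that the sets of block minima of $\pi_1,\dots,\pi_s$ all coincide. *)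

theory Defs
  imports Complex_Main
begin

text \<open>Stirling numbers of the second kind with level \<open>s\<close>; for \<open>s = 1\<close> these are
  the ordinary Stirling numbers of the second kind. The intended range is \<open>s \<ge> 1\<close>.\<close>

fun stirling2_level :: "nat \<Rightarrow> nat \<Rightarrow> nat \<Rightarrow> nat" where
  "stirling2_level s 0 0 = 1"
| "stirling2_level s 0 (Suc k) = 0"
| "stirling2_level s (Suc n) 0 = 0"
| "stirling2_level s (Suc n) (Suc k) =
     stirling2_level s n k + (Suc k) ^ s * stirling2_level s n (Suc k)"

end

theory Submission
  imports Defs
begin

text \<open>Put \<open>x\<^sub>j = j\<^sup>s\<close>. The divided difference of \<open>t\<^sup>n\<close> at the nodes \<open>x\<^sub>0, \<dots>, x\<^sub>k\<close>, that is
  \<open>\<Sum>\<^sub>j x\<^sub>j\<^sup>n / \<Prod>\<^sub>i\<^sub>\<noteq>\<^sub>j (x\<^sub>j - x\<^sub>i)\<close>, satisfies the recurrence of the level-\<open>s\<close> Stirling numbers and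
  hence equals them for all \<open>n\<close> and \<open>k\<close>. Expanding the numerator of the claimed formula gives this
  divided difference minus \<open>x\<^sub>k\<^sup>n\<^sup>-\<^sup>k\<^sup>+\<^sup>1\<close> times the one of \<open>t\<^sup>k\<^sup>-\<^sup>1\<close>, which vanishes because the Stirling
  number of \<open>k - 1\<close> over \<open>k\<close> does. The summands for \<open>j = 0\<close> and \<open>j = k\<close> are zero.\<close>

text \<open>For \<open>j\<close> other than \<open>q\<close> the factor \<open>x j - x q\<close>
  cancels against the denominator, injectivity making it nonzero; at \<open>j = q\<close> it kills
  the summand.\<close>

lemma divided_sum_remove_node:
  fixes x f :: "'i \<Rightarrow> 'a::field"
  assumes "finite A" "inj_on x A" "q \<in> A"
  shows "(\<Sum>j\<in>A. (x j - x q) * f j / (\<Prod>i\<in>A - {j}. x j - x i)) =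
         (\<Sum>j\<in>A - {q}. f j / (\<Prod>i\<in>A - {q} - {j}. x j - x i))"
proof -
  have "(x j - x q) * f j / (\<Prod>i\<in>A - {j}. x j - x i) =
        f j / (\<Prod>i\<in>A - {q} - {j}. x j - x i)" if j: "j \<in> A - {q}" for j
  proof -
    have "(\<Prod>i\<in>A - {j}. x j - x i) = (x j - x q) * (\<Prod>i\<in>A - {j} - {q}. x j - x i)"
      using assms j by (intro prod.remove) auto
    moreover have "x j - x q \<noteq> 0"
      using assms j by (auto dest: inj_onD)
    moreover have "A - {j} - {q} = A - {q} - {j}"
      by auto
    ultimately show ?thesis
      by simp
  qed
  then show ?thesis
    using assms by (simp add: sum.remove[of A q])
qed

text \<open>Induction on the number of nodes: removing \<open>p\<close> or \<open>q\<close> leaves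
  sets of the same size, hence the same sum.\<close>

lemma divided_sum_one:
  fixes x :: "'i \<Rightarrow> 'a::field"
  assumes "finite A" "inj_on x A"
  shows "(\<Sum>j\<in>A. 1 / (\<Prod>i\<in>A - {j}. x j - x i)) = (if card A = 1 then 1 else 0)"
  using assms
proof (induction "card A" arbitrary: A rule: less_induct)
  case less
  let ?S = "\<lambda>A. \<Sum>j\<in>A. 1 / (\<Prod>i\<in>A - {j}. x j - x i)"
  consider "card A = 0" | "card A = 1" | "card A \<ge> 2"
    by linarith
  then show ?case
  proof cases
    case 1
    then show ?thesis
      using less.prems by simp
  next
    case 2
    then show ?thesis
      by (auto simp: card_1_singleton_iff)
  next
    case 3
    then obtain p q where pq: "p \<in> A" "q \<in> A" "p \<noteq> q"
      by (metis card_2_iff' obtain_subset_with_card_n subset_iff)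
    have S: "?S (A - {p}) = ?S (A - {q})"
      using less.hyps[of "A - {p}"] less.hyps[of "A - {q}"] less.prems pq 3
      by (simp add: inj_on_diff)
    \<comment> \<open>In each summand \<open>x p - x q\<close> is
      \<open>(x j - x q) - (x j - x p)\<close>, and either difference removes one node.\<close>
    have "(x p - x q) * ?S A =
        (\<Sum>j\<in>A. (x j - x q) * 1 / (\<Prod>i\<in>A - {j}. x j - x i)) -
        (\<Sum>j\<in>A. (x j - x p) * 1 / (\<Prod>i\<in>A - {j}. x j - x i))"
      by (simp add: sum_distrib_left flip: sum_subtractf diff_divide_distrib)
    also have "\<dots> = 0"
      using divided_sum_remove_node[OF less.prems, of q "\<lambda>_. 1"]
        divided_sum_remove_node[OF less.prems, of p "\<lambda>_. 1"] pq S by simp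
    finally have "?S A = 0"
      using less.prems pq by (auto dest: inj_onD)
    then show ?thesis
      using 3 by simp
  qed
qed

text \<open>With \<open>x_j = j^s\<close>, the recurrence comes from
  \<open>x_j^(n+1) = (x_j - x_k) x_j^n + x_k x_j^n\<close>: the first part loses the node
  \<open>x_k\<close>, the second is \<open>x_k\<close> times the sum for \<open>n\<close>.\<close>

lemma stirling2_level_eq_divided_sum:
  assumes "s \<ge> 1"
  shows "real (stirling2_level s n k) =
    (\<Sum>j = 0..k. (real j ^ s) ^ n / (\<Prod>i \<in> {0..k} - {j}. real j ^ s - real i ^ s))"
proof -
  have inj: "inj_on (\<lambda>j. real j ^ s) A" for A
    using assms by (auto intro!: inj_onI simp: power_eq_iff_eq_base)
  show ?thesis
  proof (induction n arbitrary: k)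
    case 0
    \<comment> \<open>All numerators are 1, and \<open>{0..k}\<close> is a singleton exactly when
      \<open>k = 0\<close>.\<close>
    show ?case
      using divided_sum_one[OF _ inj, of "{0..k}"] by (cases k) auto
  next
    case (Suc n)
    show ?case
    proof (cases k)
      case 0
      then show ?thesis
        using assms by simp
    next
      case (Suc l)
      let ?D = "\<lambda>j. \<Prod>i \<in> {0..k} - {j}. real j ^ s - real i ^ s"
      have "{0..k} - {k} = {0..l}"
        using Suc by auto
      then have "(\<Sum>j = 0..k. (real j ^ s - real k ^ s) * (real j ^ s) ^ n / ?D j) =
          real (stirling2_level s n l)"
        using divided_sum_remove_node[OF _ inj, of "{0..k}" k "\<lambda>j. (real j ^ s) ^ n"] Suc.IH[of l]
        by simp
      moreover have "(\<Sum>j = 0..k. (real j ^ s - real k ^ s) * (real j ^ s) ^ n / ?D j) =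
          (\<Sum>j = 0..k. (real j ^ s) ^ Suc n / ?D j) - real k ^ s * real (stirling2_level s n k)"
        unfolding Suc.IH[of k]
        by (simp add: sum_distrib_left left_diff_distrib diff_divide_distrib sum_subtractf)
      ultimately show ?thesis
        using Suc by simp
    qed
  qed
qed

lemma stirling2_level_eq_0: "n < k \<Longrightarrow> stirling2_level s n k = 0"
  by (induction s n k rule: stirling2_level.induct) auto

lemma stirling2_level_1: "n \<ge> 1 \<Longrightarrow> stirling2_level s n 1 = 1"
proof (induction n rule: dec_induct)
  case (step n)
  then show ?case
    by (cases n) auto
qed simp

theorem theorem1:
  fixes s :: nat
  assumes "s \<ge> 1"
  shows "(\<forall>n k :: nat. 2 \<le> k \<and> k \<le> n \<longrightarrow>
            real (stirling2_level s n k) =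
              (\<Sum>j = 1..k - 1.
                 real j ^ ((k - 1) * s) *
                   (real j ^ ((n - k + 1) * s) - real k ^ ((n - k + 1) * s)) /
                 (\<Prod>i \<in> {0..k} - {j}. real j ^ s - real i ^ s)))
       \<and> (\<forall>n :: nat. n \<ge> 1 \<longrightarrow> stirling2_level s n 1 = 1)"
proof (intro conjI allI impI)
  fix n k :: nat
  assume k: "2 \<le> k \<and> k \<le> n"
  let ?D = "\<lambda>j. \<Prod>i \<in> {0..k} - {j}. real j ^ s - real i ^ s"
  let ?t = "\<lambda>j. real j ^ ((k - 1) * s) *
    (real j ^ ((n - k + 1) * s) - real k ^ ((n - k + 1) * s)) / ?D j"
  have exps: "(k - 1) * s + (n - k + 1) * s = n * s"
  proof -
    have "k - 1 + (n - k + 1) = n"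
      using k by simp
    then show ?thesis
      by (metis add_mult_distrib)
  qed
  have t: "?t j = (real j ^ s) ^ n / ?D j -
      real k ^ ((n - k + 1) * s) * ((real j ^ s) ^ (k - 1) / ?D j)" for j
  proof -
    have "real j ^ ((k - 1) * s) * (real j ^ ((n - k + 1) * s) - real k ^ ((n - k + 1) * s)) =
        (real j ^ s) ^ n - real k ^ ((n - k + 1) * s) * (real j ^ s) ^ (k - 1)"
      unfolding right_diff_distrib power_add[symmetric] exps power_mult[symmetric]
      by (simp add: mult.commute)
    then show ?thesis
      by (simp only: diff_divide_distrib times_divide_eq_right)
  qed
  have "real (stirling2_level s n k) =
      real (stirling2_level s n k) -
        real k ^ ((n - k + 1) * s) * real (stirling2_level s (k - 1) k)"
    using k by (simp add: stirling2_level_eq_0)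
  also have "\<dots> = (\<Sum>j = 0..k. ?t j)"
    unfolding t stirling2_level_eq_divided_sum[OF assms] sum_subtractf sum_distrib_left ..
  also have "\<dots> = (\<Sum>j = 1..k - 1. ?t j)"
  proof (rule sum.mono_neutral_right)
    show "\<forall>j\<in>{0..k} - {1..k - 1}. ?t j = 0"
    proof
      fix j
      assume "j \<in> {0..k} - {1..k - 1}"
      then have "j = 0 \<or> j = k"
        by auto
      \<comment> \<open>At \<open>j = 0\<close> the first power vanishes, its exponent
        \<open>(k - 1) * s\<close> being positive; at \<open>j = k\<close> the difference
        does.\<close>
      then show "?t j = 0"
        using k assms by auto
    qed
  qed auto
  finally show "real (stirling2_level s n k) = (\<Sum>j = 1..k - 1. ?t j)" .
qed (rule stirling2_level_1)

end
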